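(* Let $n\le m$, $\mathbb{F}=\mathbb{F}_q$, $\delta\in\{1,\ldots,n\}$, and $\ell=n-\delta+1$. For $(\alpha,\beta)\in[m]\times[\ell]$ let $B_{\alpha,\beta}\in\mathbb{F}^{m\times (n-\ell)}$ be randomly chosen matrices (all entries of all these matrices independent and uniformly distributed on $\mathbb{F}$) and set $$A_{\alpha,\beta}=\big(\underbrace{0\mid\cdots\mid0\mid e_\alpha\mid 0\mid\cdots\mid0}_{\ell \text{ columns}}\mid B_{\alpha,\beta}\big)\in\mathbb{F}^{m\times n},$$ where $e_{\alpha}$, the $\alpha$-th standard basis vector in $\mathbb{F}^m$, is in the $\beta$-th column. Then the rank-metric code $\mathcal{C}=\big\langle A_{\alpha,\beta}\mid (\alpha,\beta)\in[m]\times[\ell]\big\rangle_{\mathbb{F}}$ satisfies $$\mathrm{Prob}\big(\mathcal{C}\text{ is an }[m\times n;\delta]\text{-MRD code}\big)\leq \Big(\frac{s_m(q)}{q^{m^2}}\Big)^{(\delta-1)\ell}.$$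
   Context: $q$ is a prime power and $[k]=\{1,\ldots,k\}$. For $n\le m$, an $[m\times n;\delta]$-MRD code is an $\mathbb{F}_q$-subspace of $\mathbb{F}_q^{m\times n}$ of dimension $m(n-\delta+1)$ whose rank distance (minimum rank of nonzero elements) is $\delta$. $s_m(q)=|\{A\in\mathbb{F}_q^{m\times m}\mid \sigma(A)=\emptyset\}|$, where $\sigma(A)$ is the set of eigenvalues of $A$ lying in $\mathbb{F}_q$. *)

theory Defs
  imports
    "HOL-Probability.Probability"
    "Jordan_Normal_Form.DL_Rank"
    "Jordan_Normal_Form.Spectral_Radius"
begin

text \<open>
  The finite field is a type \<open>'a :: {field, finite}\<close>, so \<open>q = CARD('a)\<close>, and matrices over it are
  those of \<^theory>\<open>Jordan_Normal_Form.Matrix\<close>. Rows, columns and the index pairs \<open>(\<alpha>, \<beta>)\<close> are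
  counted from \<open>0\<close>. Subspace, dimension and span refer to the vector space \<open>module_mat TYPE('a) m n\<close>
  of all \<open>m \<times> n\<close> matrices over \<open>class_ring\<close>.
\<close>

lemma vectorspace_module_mat: "vectorspace class_ring (module_mat TYPE('a::field) m n)"
proof -
  interpret abelian_group "module_mat TYPE('a) m n"
    by (rule abelian_group_mat)
  show ?thesis
    by unfold_locales
      (auto simp: module_mat_simps add_smult_distrib_right_mat add_smult_distrib_left_mat ac_simps)
qed

text \<open>Only meaningful for \<open>C \<noteq> {0}\<close>; the set of ranks is bounded by \<open>m\<close>, so \<open>Min\<close> is attained.\<close>

definition rank_distance :: "nat \<Rightarrow> nat \<Rightarrow> 'a::field mat set \<Rightarrow> nat" where
  "rank_distance m n C = Min (vec_space.rank m ` (C - {0\<^sub>m m n}))"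

text \<open>To be used for \<open>1 \<le> \<delta> \<le> n \<le> m\<close> only; in particular the subtraction is then not truncated.\<close>

definition is_MRD_code :: "nat \<Rightarrow> nat \<Rightarrow> nat \<Rightarrow> 'a::field mat set \<Rightarrow> bool" where
  "is_MRD_code m n \<delta> C \<longleftrightarrow>
     VectorSpace.subspace class_ring C (module_mat TYPE('a) m n) \<and>
     vectorspace.dim class_ring (module_mat TYPE('a) m n\<lparr>carrier := C\<rparr>) = m * (n - \<delta> + 1) \<and>
     rank_distance m n C = \<delta>"

definition num_spectrum_free :: "'a::{field, finite} itself \<Rightarrow> nat \<Rightarrow> nat" where
  "num_spectrum_free _ m = card {A :: 'a mat. A \<in> carrier_mat m m \<and> spectrum A = {}}"

definition generator_mat :: "nat \<Rightarrow> nat \<Rightarrow> nat \<Rightarrow> nat \<Rightarrow> 'a::field mat \<Rightarrow> 'a mat" where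
  "generator_mat m l \<alpha> \<beta> B =
     mat_of_cols m (map (\<lambda>j. if j = \<beta> then unit_vec m \<alpha> else 0\<^sub>v m) [0..<l] @ cols B)"

definition generated_code :: "nat \<Rightarrow> nat \<Rightarrow> nat \<Rightarrow> (nat \<Rightarrow> nat \<Rightarrow> 'a::field mat) \<Rightarrow> 'a mat set" where
  "generated_code m n l B =
     LinearCombinations.module.span class_ring (module_mat TYPE('a) m n)
       {generator_mat m l \<alpha> \<beta> (B \<alpha> \<beta>) | \<alpha> \<beta>. \<alpha> < m \<and> \<beta> < l}"

end

theory Submission
  imports Defs
begin

text \<open>
  The \<open>j\<close>-th of the last \<open>\<delta> - 1\<close> columns of a codeword with first columns \<open>x\<^sub>0, \<dots>, x\<^bsub>l-1\<^esub>\<close> is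
  \<open>\<Sum>\<beta>. N\<^bsub>\<beta>,j\<^esub> x\<^sub>\<beta>\<close>, where \<open>N\<^bsub>\<beta>,j\<^esub>\<close> is the square matrix whose \<open>\<alpha>\<close>-th column is the \<open>j\<close>-th column of
  \<open>B\<^bsub>\<alpha>,\<beta>\<^esub>\<close>. If some \<open>N\<^bsub>\<beta>,j\<^esub>\<close> had an eigenvector \<open>x\<close> in the field, the codeword with \<open>x\<^sub>\<beta> = x\<close> as its
  only nonzero block would have at most \<open>\<delta>\<close> nonzero columns, two of them proportional, hence rank less
  than \<open>\<delta>\<close>. So an MRD code forces all the \<open>(\<delta> - 1) l\<close> independent uniform matrices
  \<open>N\<^bsub>\<beta>,j\<^esub>\<close> to have empty spectrum.
\<close>

section \<open>Rank and finiteness of matrix spaces\<close>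

text \<open>Rank is the dimension of the column span, and dimension is monotone for nested
  subspaces. The column counts may differ, so a matrix can be compared with a narrower one whose
  columns span at least as much.\<close>

lemma (in vec_space) rank_mono_span:
  assumes A: "A \<in> carrier_mat n nc" and A': "A' \<in> carrier_mat n nc'"
    and sub: "set (cols A) \<subseteq> span (set (cols A'))"
  shows "rank A \<le> rank A'"
proof -
  have c: "set (cols A) \<subseteq> carrier_vec n" "set (cols A') \<subseteq> carrier_vec n"
    using A A' cols_dim by blast+
  have s: "subspace class_ring (span (set (cols A))) V" "subspace class_ring (span (set (cols A'))) V"
    using c span_is_subspace by auto
  have "span (set (cols A)) \<subseteq> span (set (cols A'))"
    using span_subsetI[OF c(2) sub] .
  from nested_subspaces[OF s(2) s(1) this]
  have "subspace class_ring (span (set (cols A))) (span_vs (set (cols A')))" .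
  from vectorspace.subspace_dim[OF subspace_is_vs[OF s(2)] this]
  show ?thesis
    unfolding rank_def using fin_dim_span_cols[OF A] fin_dim_span_cols[OF A'] by simp
qed

lemma finite_carrier_mat: "finite (carrier_mat m n :: 'a::finite mat set)"
proof (rule finite_subset)
  show "(carrier_mat m n :: 'a mat set) \<subseteq> mat m n ` (({..<m} \<times> {..<n}) \<rightarrow>\<^sub>E UNIV)"
  proof
    fix A :: "'a mat" assume A: "A \<in> carrier_mat m n"
    then have "A = mat m n (restrict (\<lambda>p. A $$ p) ({..<m} \<times> {..<n}))"
      by (intro eq_matI) auto
    moreover have "restrict (\<lambda>p. A $$ p) ({..<m} \<times> {..<n}) \<in> ({..<m} \<times> {..<n}) \<rightarrow>\<^sub>E UNIV"
      by simp
    ultimately show "A \<in> mat m n ` (({..<m} \<times> {..<n}) \<rightarrow>\<^sub>E UNIV)"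
      by (rule image_eqI)
  qed
qed (auto intro!: finite_PiE)

section \<open>Codewords supported on one block\<close>

definition slice_mat :: "nat \<Rightarrow> (nat \<Rightarrow> nat \<Rightarrow> 'a::field mat) \<Rightarrow> nat \<Rightarrow> nat \<Rightarrow> 'a mat" where
  "slice_mat m B \<beta> j = mat m m (\<lambda>(i, \<alpha>). B \<alpha> \<beta> $$ (i, j))"

text \<open>The combination of the generators with fixed \<beta>, where the generator of index
  \<alpha> gets the coefficient \<open>x $ \<alpha>\<close>. Giving it entrywise exposes each later
  column as a slice applied to \<open>x\<close>.\<close>

definition block_codeword ::
    "nat \<Rightarrow> nat \<Rightarrow> nat \<Rightarrow> (nat \<Rightarrow> nat \<Rightarrow> 'a::field mat) \<Rightarrow> nat \<Rightarrow> 'a vec \<Rightarrow> 'a mat" where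
  "block_codeword m n l B \<beta> x = mat m n (\<lambda>(i, c).
     if c < l then (if c = \<beta> then x $ i else 0) else (slice_mat m B \<beta> (c - l) *\<^sub>v x) $ i)"

lemma generator_mat_carrier:
  assumes "B \<in> carrier_mat m (n - l)" "l \<le> n"
  shows "generator_mat m l \<alpha> \<beta> B \<in> carrier_mat m n"
  using assms by (intro carrier_matI) (simp_all add: generator_mat_def)

lemma generator_mat_index:
  assumes "B \<in> carrier_mat m (n - l)" "l \<le> n" "i < m" "c < n"
  shows "generator_mat m l \<alpha> \<beta> B $$ (i, c) =
    (if c < l then (if c = \<beta> \<and> i = \<alpha> then 1 else 0) else B $$ (i, c - l))"
proof -
  have "length (map (\<lambda>j. if j = \<beta> then unit_vec m \<alpha> else 0\<^sub>v m :: 'a vec) [0..<l] @ cols B) = n"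
    using assms by auto
  then show ?thesis
    using assms
    unfolding generator_mat_def
    by (auto simp: mat_of_cols_index nth_append unit_vec_def)
qed

lemma block_codeword_in_code:
  fixes B :: "nat \<Rightarrow> nat \<Rightarrow> 'a::field mat"
  assumes B: "\<And>\<alpha> \<beta>. \<alpha> < m \<Longrightarrow> \<beta> < l \<Longrightarrow> B \<alpha> \<beta> \<in> carrier_mat m (n - l)"
    and l: "l \<le> n" "\<beta> < l" and x: "x \<in> carrier_vec m"
  shows "block_codeword m n l B \<beta> x \<in> generated_code m n l B"
proof -
  interpret V: matrix_vs m n "TYPE('a)" .
  let ?G = "{generator_mat m l \<alpha> \<beta> (B \<alpha> \<beta>) | \<alpha> \<beta>. \<alpha> < m \<and> \<beta> < l}"
  have G: "?G \<subseteq> carrier_mat m n"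
    using generator_mat_carrier[OF B l(1)] by blast
  have sm: "submodule class_ring (V.span ?G) V.V"
    by (rule V.span_is_submodule) (use G in simp)
  \<comment> \<open>Partial sums of the combination: each step adds one scaled generator, so
    membership needs only closure of the span under addition and scaling.\<close>
  define W where "W k = mat m n (\<lambda>p. \<Sum>\<alpha><k. x $ \<alpha> * generator_mat m l \<alpha> \<beta> (B \<alpha> \<beta>) $$ p)" for k
  have W: "W k \<in> V.span ?G" if "k \<le> m" for k
    using that
  proof (induction k)
    case 0
    have "W 0 = 0\<^sub>m m n" by (auto simp: W_def)
    then show ?case using submodule.zero_closed[OF sm] by (simp add: module_mat_simps)
  next
    case (Suc k)
    let ?A = "generator_mat m l k \<beta> (B k \<beta>)"
    have "k < m" using Suc.prems by simp
    then have "?A \<in> ?G" using l by blast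
    then have A: "?A \<in> V.span ?G" using V.in_own_span G by auto
    have "?A \<in> carrier_mat m n" using \<open>?A \<in> ?G\<close> G by auto
    then have "W (Suc k) = W k + x $ k \<cdot>\<^sub>m ?A"
      by (auto simp: W_def)
    moreover have "x $ k \<cdot>\<^sub>m ?A \<in> V.span ?G"
      using submodule.smult_closed[OF sm _ A] by (simp add: matrix_vs_simps)
    ultimately show ?case
      using submodule.m_closed[OF sm Suc.IH] Suc.prems by (simp add: module_mat_simps)
  qed
  have "W m = block_codeword m n l B \<beta> x"
  proof (rule eq_matI)
    fix i c assume "i < dim_row (block_codeword m n l B \<beta> x)" "c < dim_col (block_codeword m n l B \<beta> x)"
    then have ic: "i < m" "c < n" by (auto simp: block_codeword_def)
    have "generator_mat m l \<alpha> \<beta> (B \<alpha> \<beta>) $$ (i, c) =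
        (if c < l then (if c = \<beta> \<and> i = \<alpha> then 1 else 0) else B \<alpha> \<beta> $$ (i, c - l))" if "\<alpha> < m" for \<alpha>
      by (rule generator_mat_index[OF B[OF that l(2)] l(1) ic])
    then have "W m $$ (i, c) = (\<Sum>\<alpha><m. x $ \<alpha> *
        (if c < l then (if c = \<beta> \<and> i = \<alpha> then 1 else 0) else B \<alpha> \<beta> $$ (i, c - l)))"
      using ic by (simp add: W_def)
    also have "\<dots> = block_codeword m n l B \<beta> x $$ (i, c)"
    proof (cases "c < l")
      case True
      \<comment> \<open>The condition is regrouped with \<open>\<alpha> = i\<close> outermost, so
        that the sum collapses to a single term.\<close>
      have "(\<Sum>\<alpha><m. x $ \<alpha> * (if c = \<beta> \<and> i = \<alpha> then 1 else 0)) =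
          (\<Sum>\<alpha><m. if \<alpha> = i then (if c = \<beta> then x $ \<alpha> else 0) else 0)"
        by (intro sum.cong) auto
      with True ic show ?thesis by (simp add: block_codeword_def)
    next
      case False
      with ic x show ?thesis
        by (simp add: block_codeword_def slice_mat_def scalar_prod_def atLeast0LessThan mult.commute)
    qed
    finally show "W m $$ (i, c) = block_codeword m n l B \<beta> x $$ (i, c)" .
  qed (auto simp: W_def block_codeword_def)
  with W[of m] show ?thesis
    unfolding generated_code_def by simp
qed

text \<open>The eigenvector equation makes column \<open>l + j\<close> a multiple of
  \<open>x\<close>, so \<open>x\<close> and the other \<open>n - l - 1\<close> slice images span all
  columns.\<close>

lemma rank_block_codeword_eigenvector:
  fixes B :: "nat \<Rightarrow> nat \<Rightarrow> 'a::field mat"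
  assumes l: "l \<le> n" "\<beta> < l" and j: "j < n - l"
    and x: "x \<in> carrier_vec m" "slice_mat m B \<beta> j *\<^sub>v x = k \<cdot>\<^sub>v x"
  shows "vec_space.rank m (block_codeword m n l B \<beta> x) \<le> n - l"
proof -
  interpret vec_space "TYPE('a)" m .
  let ?W = "block_codeword m n l B \<beta> x"
  let ?y = "\<lambda>c. slice_mat m B \<beta> c *\<^sub>v x"
  define vs where "vs = x # map ?y (filter (\<lambda>c. c \<noteq> j) [0..<n - l])"
  define W' where "W' = mat_of_cols m vs"
  have y: "?y c \<in> carrier_vec m" for c
    by (rule mult_mat_vec_carrier[OF _ x(1)]) (simp add: slice_mat_def)
  \<comment> \<open>The list loses at least the element \<open>j\<close>, which makes room for the
    extra vector \<open>x\<close> in the bound \<open>n - l\<close>.\<close>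
  have "length (filter (\<lambda>c. c \<noteq> j) [0..<n - l]) < length [0..<n - l]"
    by (rule length_filter_less[of j]) (use j in auto)
  then have len: "length vs \<le> n - l" by (simp add: vs_def)
  have vs: "set vs \<subseteq> carrier_vec m" using x y by (auto simp: vs_def)
  then have cols: "cols W' = vs" by (simp add: W'_def)
  have W: "?W \<in> carrier_mat m n" by (simp add: block_codeword_def)
  have W': "W' \<in> carrier_mat m (length vs)" by (simp add: W'_def)
  have sm: "submodule class_ring (span (set vs)) V" by (rule span_is_submodule) (use vs in simp)
  have own: "v \<in> span (set vs)" if "v \<in> set vs" for v
    using in_own_span[of "set vs"] vs that by auto
  have sc: "a \<cdot>\<^sub>v x \<in> span (set vs)" for a
    by (rule smult_in_span[OF vs own]) (simp add: vs_def)
  have "col ?W c \<in> span (set vs)" if c: "c < n" for c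
  proof (cases "c < l")
    case True
    \<comment> \<open>Zero columns are written as 0 times \<open>x\<close>, so one span argument
      covers all of the first \<open>l\<close> columns.\<close>
    then have "col ?W c = (if c = \<beta> then 1 else 0) \<cdot>\<^sub>v x"
      using c x by (intro eq_vecI) (auto simp: block_codeword_def)
    then show ?thesis using sc by metis
  next
    case False
    then have e: "col ?W c = ?y (c - l)"
      using c x y[of "c - l"] by (intro eq_vecI) (auto simp: block_codeword_def slice_mat_def)
    show ?thesis
    proof (cases "c - l = j")
      case True
      then show ?thesis using e x sc by simp
    next
      case False
      then show ?thesis using e c \<open>\<not> c < l\<close> by (intro own) (auto simp: vs_def)
    qed
  qed
  then have "set (cols ?W) \<subseteq> span (set (cols W'))"
    unfolding cols using W by (auto simp: cols_def)
  from rank_mono_span[OF W W' this] rank_le_nc[OF W'] len show ?thesis by simp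
qed

lemma MRD_imp_spectrum_slice_empty:
  fixes B :: "nat \<Rightarrow> nat \<Rightarrow> 'a::{field, finite} mat"
  assumes B: "\<And>\<alpha> \<beta>. \<alpha> < m \<Longrightarrow> \<beta> < l \<Longrightarrow> B \<alpha> \<beta> \<in> carrier_mat m (n - l)"
    and \<delta>: "n - l < \<delta>" and l: "l \<le> n" "\<beta> < l" and j: "j < n - l"
    and mrd: "is_MRD_code m n \<delta> (generated_code m n l B)"
  shows "spectrum (slice_mat m B \<beta> j) = {}"
proof (rule ccontr)
  assume "spectrum (slice_mat m B \<beta> j) \<noteq> {}"
  then obtain k x where "eigenvector (slice_mat m B \<beta> j) x k"
    unfolding spectrum_def eigenvalue_def by blast
  then have x: "x \<in> carrier_vec m" "x \<noteq> 0\<^sub>v m" "slice_mat m B \<beta> j *\<^sub>v x = k \<cdot>\<^sub>v x"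
    by (simp_all add: eigenvector_def slice_mat_def)
  let ?C = "generated_code m n l B" and ?W = "block_codeword m n l B \<beta> x"
  have sub: "?C \<subseteq> carrier_mat m n"
    using mrd unfolding is_MRD_code_def VectorSpace.subspace_def
    by (auto dest!: submodule.subset simp: module_mat_simps)
  \<comment> \<open>A nonzero coordinate of \<open>x\<close> reappears in column \<beta>, so the
    codeword is nonzero and its rank counts in the minimum.\<close>
  obtain i where i: "i < m" "x $ i \<noteq> 0"
    using x(1,2) by (metis carrier_vecD eq_vecI index_zero_vec(1,2))
  then have "?W $$ (i, \<beta>) \<noteq> 0\<^sub>m m n $$ (i, \<beta>)"
    using l by (simp add: block_codeword_def)
  moreover have "?W \<in> ?C"
    by (rule block_codeword_in_code[OF B l x(1)])
  ultimately have "?W \<in> ?C - {0\<^sub>m m n}" by auto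
  \<comment> \<open>\<open>Min\<close> is a lower bound only on finite sets; finiteness of the field
    provides this.\<close>
  moreover have "finite (?C - {0\<^sub>m m n})"
    using finite_subset[OF sub finite_carrier_mat] by blast
  ultimately have "rank_distance m n ?C \<le> vec_space.rank m ?W"
    unfolding rank_distance_def by (intro Min_le) auto
  also have "\<dots> \<le> n - l"
    by (rule rank_block_codeword_eigenvector[OF l j x(1,3)])
  finally show False using \<delta> mrd by (simp add: is_MRD_code_def)
qed

section \<open>From probabilities to counting\<close>

text \<open>By independence every value of the whole family has the same probability, so the family
  is uniform on \<open>I \<rightarrow>\<^sub>E UNIV\<close>. Restriction to \<open>I\<close> makes
  each value a unique extensional function, and events become finite disjoint unions of point
  events.\<close>

lemma (in prob_space) prob_indep_uniform:
  fixes X :: "'i \<Rightarrow> 'a \<Rightarrow> 'b::finite"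
  assumes I: "finite I"
    and indep: "indep_vars (\<lambda>_. count_space UNIV) X I"
    and unif: "\<And>i. i \<in> I \<Longrightarrow> distr M (count_space UNIV) (X i) = uniform_count_measure UNIV"
    and G: "G \<subseteq> I \<rightarrow>\<^sub>E UNIV"
  shows "{\<omega> \<in> space M. restrict (\<lambda>i. X i \<omega>) I \<in> G} \<in> events" (is ?meas)
    and "prob {\<omega> \<in> space M. restrict (\<lambda>i. X i \<omega>) I \<in> G} = card G / real CARD('b) ^ card I" (is ?eq)
proof -
  define E where "E f = {\<omega> \<in> space M. restrict (\<lambda>i. X i \<omega>) I = f}" for f
  have rv: "X i \<in> measurable M (count_space UNIV)" if "i \<in> I" for i
    using indep that by (auto simp: indep_vars_def2)
  have E: "E f \<in> events \<and> prob (E f) = 1 / real CARD('b) ^ card I" if "f \<in> G" for f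
  proof (cases "I = {}")
    \<comment> \<open>The product rule for independence needs a nonempty index set. In the theorem
      this case is \<delta> = 1, where there are no random entries.\<close>
    case True
    with that G have "f = (\<lambda>_. undefined)" by auto
    with True have "E f = space M" by (simp add: E_def restrict_def)
    with True show ?thesis by (simp add: prob_space)
  next
    case False
    have f: "f \<in> extensional I" using that G by (auto simp: PiE_def)
    have E_eq: "E f = (\<Inter>i\<in>I. X i -` {f i} \<inter> space M)"
      using False f unfolding E_def by (auto simp: fun_eq_iff extensional_def)
    have "prob (X i -` {f i} \<inter> space M) = 1 / CARD('b)" if "i \<in> I" for i
      using measure_distr[OF rv[OF that], of "{f i}"] unif[OF that]
      by (simp add: measure_uniform_count_measure)
    then have "prob (E f) = (\<Prod>i\<in>I. 1 / CARD('b))"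
      unfolding E_eq by (subst indep_varsD_finite[OF indep False I]) auto
    moreover have "E f \<in> events"
      unfolding E_eq using False I rv by (intro sets.finite_INT) (auto intro: measurable_sets)
    ultimately show ?thesis by (simp add: power_divide)
  qed
  have fin: "finite G" by (rule finite_subset[OF G]) (use I in \<open>auto intro!: finite_PiE\<close>)
  have eq: "{\<omega> \<in> space M. restrict (\<lambda>i. X i \<omega>) I \<in> G} = (\<Union>f\<in>G. E f)"
    by (auto simp: E_def)
  show ?meas unfolding eq using fin E by auto
  have "prob (\<Union>f\<in>G. E f) = (\<Sum>f\<in>G. prob (E f))"
    by (rule finite_measure_finite_Union[OF fin]) (use E in \<open>auto simp: disjoint_family_on_def E_def\<close>)
  then show ?eq unfolding eq using E by simp
qed

text \<open>The slices partition the entries, so \<open>f\<close> is determined by its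
  \<open>r * l\<close> slices, each of which has at most \<open>card S\<close> choices.\<close>

lemma card_slices_le:
  fixes S :: "'a::{field, finite} mat set"
  assumes S: "S \<subseteq> carrier_mat m m"
  shows "card {f \<in> ({..<m} \<times> {..<l} \<times> {..<m} \<times> {..<r}) \<rightarrow>\<^sub>E UNIV.
      \<forall>\<beta><l. \<forall>j<r. mat m m (\<lambda>(i, \<alpha>). f (\<alpha>, \<beta>, i, j)) \<in> S} \<le> card S ^ (r * l)"
    (is "card ?G \<le> _")
proof -
  let ?J = "{..<l} \<times> {..<r}"
  define \<Phi> :: "(nat \<times> nat \<times> nat \<times> nat \<Rightarrow> 'a) \<Rightarrow> nat \<times> nat \<Rightarrow> 'a mat"
    where "\<Phi> f = restrict (\<lambda>(\<beta>, j). mat m m (\<lambda>(i, \<alpha>). f (\<alpha>, \<beta>, i, j))) ?J" for f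
  have "inj_on \<Phi> ?G"
  proof (rule inj_onI)
    fix f g assume f: "f \<in> ?G" and g: "g \<in> ?G" and eq: "\<Phi> f = \<Phi> g"
    show "f = g"
    proof (rule PiE_ext[where s = "\<lambda>_. UNIV"])
      fix p assume "p \<in> {..<m} \<times> {..<l} \<times> {..<m} \<times> {..<r}"
      then obtain \<alpha> \<beta> i j where p: "p = (\<alpha>, \<beta>, i, j)" "\<alpha> < m" "\<beta> < l" "i < m" "j < r" by auto
      \<comment> \<open>The value of \<open>f\<close> at \<open>(\<alpha>, \<beta>, i, j)\<close> is
        recovered as entry \<open>(i, \<alpha>)\<close> of the slice
        \<open>(\<beta>, j)\<close>.\<close>
      from eq have "\<Phi> f (\<beta>, j) $$ (i, \<alpha>) = \<Phi> g (\<beta>, j) $$ (i, \<alpha>)" by simp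
      with p show "f p = g p" by (simp add: \<Phi>_def)
    qed (use f g in auto)
  qed
  moreover have "\<Phi> ` ?G \<subseteq> ?J \<rightarrow>\<^sub>E S"
    by (auto simp: \<Phi>_def)
  moreover have "finite (?J \<rightarrow>\<^sub>E S)"
    using finite_subset[OF S finite_carrier_mat] by (auto intro!: finite_PiE)
  ultimately have "card ?G \<le> card (?J \<rightarrow>\<^sub>E S)"
    by (rule card_inj_on_le)
  then show ?thesis by (simp add: card_funcsetE mult.commute)
qed

section \<open>The probability bound\<close>

theorem theorem7p6:
  fixes M :: "'w measure"
    and B :: "nat \<Rightarrow> nat \<Rightarrow> 'w \<Rightarrow> 'a::{field, finite} mat"
    and m n \<delta> l :: nat
  assumes "prob_space M"
    and "n \<le> m" and "\<delta> \<in> {1..n}" and "l = n - \<delta> + 1"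
    and "\<And>\<alpha> \<beta> \<omega>. \<alpha> < m \<Longrightarrow> \<beta> < l \<Longrightarrow> \<omega> \<in> space M \<Longrightarrow> B \<alpha> \<beta> \<omega> \<in> carrier_mat m (n - l)"
    and "prob_space.indep_vars M (\<lambda>_. count_space UNIV)
           (\<lambda>(\<alpha>, \<beta>, i, j) \<omega>. B \<alpha> \<beta> \<omega> $$ (i, j))
           ({..<m} \<times> {..<l} \<times> {..<m} \<times> {..<n - l})"
    and "\<And>\<alpha> \<beta> i j. \<alpha> < m \<Longrightarrow> \<beta> < l \<Longrightarrow> i < m \<Longrightarrow> j < n - l \<Longrightarrow>
           distr M (count_space UNIV) (\<lambda>\<omega>. B \<alpha> \<beta> \<omega> $$ (i, j)) = uniform_count_measure UNIV"
  shows "measure M {\<omega> \<in> space M. is_MRD_code m n \<delta> (generated_code m n l (\<lambda>\<alpha> \<beta>. B \<alpha> \<beta> \<omega>))}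
           \<le> (real (num_spectrum_free TYPE('a) m) / real CARD('a) ^ (m\<^sup>2)) ^ ((\<delta> - 1) * l)"
proof -
  interpret prob_space M by fact
  have nl: "n - l = \<delta> - 1" "l \<le> n" "n - l < \<delta>" using assms(3,4) by auto
  let ?I = "{..<m} \<times> {..<l} \<times> {..<m} \<times> {..<n - l}"
  let ?X = "\<lambda>(\<alpha>, \<beta>, i, j) \<omega>. B \<alpha> \<beta> \<omega> $$ (i, j)"
  define S :: "'a mat set" where "S = {A \<in> carrier_mat m m. spectrum A = {}}"
  \<comment> \<open>The assignments of all random entries for which every slice has empty
    spectrum.\<close>
  define G :: "(nat \<times> nat \<times> nat \<times> nat \<Rightarrow> 'a) set"
    where "G = {f \<in> ?I \<rightarrow>\<^sub>E UNIV. \<forall>\<beta><l. \<forall>j<n - l. mat m m (\<lambda>(i, \<alpha>). f (\<alpha>, \<beta>, i, j)) \<in> S}"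
  have unif: "distr M (count_space UNIV) (?X p) = uniform_count_measure UNIV" if "p \<in> ?I" for p
    using that assms(7) by auto
  have GI: "G \<subseteq> ?I \<rightarrow>\<^sub>E UNIV" by (auto simp: G_def)
  have finI: "finite ?I" by simp
  note prob = prob_indep_uniform[OF finI assms(6) unif GI]
  have "measure M {\<omega> \<in> space M. is_MRD_code m n \<delta> (generated_code m n l (\<lambda>\<alpha> \<beta>. B \<alpha> \<beta> \<omega>))}
      \<le> prob {\<omega> \<in> space M. restrict (\<lambda>p. ?X p \<omega>) ?I \<in> G}"
  \<comment> \<open>Monotonicity asks for measurability of the larger event, which
    \<open>prob(1)\<close> supplies; the inclusion is the eigenvector argument at each
    outcome.\<close>
  proof (rule finite_measure_mono[OF _ prob(1)], safe)
    fix \<omega> assume \<omega>: "\<omega> \<in> space M"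
      and mrd: "is_MRD_code m n \<delta> (generated_code m n l (\<lambda>\<alpha> \<beta>. B \<alpha> \<beta> \<omega>))"
    have "mat m m (\<lambda>(i, \<alpha>). restrict (\<lambda>p. ?X p \<omega>) ?I (\<alpha>, \<beta>, i, j)) \<in> S"
      if "\<beta> < l" "j < n - l" for \<beta> j
    proof -
      have "mat m m (\<lambda>(i, \<alpha>). restrict (\<lambda>p. ?X p \<omega>) ?I (\<alpha>, \<beta>, i, j))
          = slice_mat m (\<lambda>\<alpha> \<beta>. B \<alpha> \<beta> \<omega>) \<beta> j"
        using that by (intro eq_matI) (auto simp: slice_mat_def)
      moreover have "spectrum (slice_mat m (\<lambda>\<alpha> \<beta>. B \<alpha> \<beta> \<omega>) \<beta> j) = {}"
        using assms(5) \<omega> nl that mrd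
        by (intro MRD_imp_spectrum_slice_empty[where n = n and \<delta> = \<delta> and l = l]) auto
      ultimately show ?thesis by (simp add: S_def slice_mat_def)
    qed
    then show "restrict (\<lambda>p. ?X p \<omega>) ?I \<in> G" by (auto simp: G_def)
  qed
  also have "\<dots> = card G / real CARD('a) ^ card ?I" by (rule prob(2))
  also have "\<dots> \<le> real (card S ^ ((n - l) * l)) / real CARD('a) ^ card ?I"
    using card_slices_le[of S m l "n - l"]
    by (intro divide_right_mono) (auto simp: G_def S_def simp del: of_nat_power)
  also have "card S = num_spectrum_free TYPE('a) m"
    by (simp add: S_def num_spectrum_free_def)
  \<comment> \<open>There are \<open>(n - l) * l\<close> slices of \<open>m\<^sup>2\<close> entries
    each, so the quotient becomes a power of the single-slice probability.\<close>
  also have "card ?I = m\<^sup>2 * ((n - l) * l)"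
    by (simp add: power2_eq_square)
  finally show ?thesis
    by (simp add: nl power_divide power_mult)
qed

end
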